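(* Let $H$ be a Hopf algebra over a field $\Bbbk$, let $N\ge1$, and let $\pi:H\to\Bbbk[\mathbb Z/N\mathbb Z]$ be a surjective cocentral Hopf algebra map. Fix: 1. an abelian subgroup $\Gamma_0\le G(H^{\mathrm{co}\,\pi})$; 2. a group homomorphism $\gamma:\Gamma_0\to\mathrm{Alg}(H,\Bbbk)$ such that $\langle\gamma(g),h_{(1)}\rangle\,g h_{(2)}g^{-1}=h_{(1)}\langle\gamma(g),h_{(2)}\rangle$ for all $g\in\Gamma_0$, $h\in H$; 3. an element $\nu\in\Gamma_0$, and define the scalar $m=\langle\gamma(\nu),\nu\rangle\in\Bbbk^*$. Identify $\mathbb Z/N\mathbb Z$ with $\{0,1,\dots,N-1\}$ and define, for $q\in\Bbbk^*$, $$\lambda^{(\nu)}(i,j)=\begin{cases}1&i+j<N\\ \nu&i+j\ge N\end{cases},\qquad \omega^{(q)}(i,j,k)=\begin{cases}1&i+j<N\\ q^k&i+j\ge N\end{cases}$$ for $i,j,k\in\{0,\dots,N-1\}$ (sums $i+j$ taken in $\mathbb Z$). Then for any $q\in\Bbbk^*$ such that $q^N=m$, the triple $(\gamma,\lambda^{(\nu)},\omega^{(q)})$ forms an associative $\mathbb Z/N\mathbb Z$-zesting datum for $H$.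
   Context: Sweedler notation is used. A Hopf algebra map $\pi:H\to\Bbbk G$ is cocentral if $h_{(1)}\otimes\pi(h_{(2)})=h_{(2)}\otimes\pi(h_{(1)})$ for all $h\in H$. $H^{\mathrm{co}\,\pi}=\{h\in H:(\pi\otimes\mathrm{id})\Delta(h)=e\otimes h\}$ is the Hopf subalgebra of coinvariants, and $G(H^{\mathrm{co}\,\pi})$ is its group of group-like elements. $\mathrm{Alg}(H,\Bbbk)$ is the group of algebra maps $H\to\Bbbk$ under the convolution product. **Associative $G$-zesting datum for $H$** (relative to a surjective cocentral $\pi:H\to\Bbbk G$ and a subgroup $\Gamma_0\le G(H^{\mathrm{co}\,\pi})$): a triple $(\gamma,\lambda,\omega)$ where - $\gamma:\Gamma_0\to\mathrm{Alg}(H,\Bbbk)$ is a group homomorphism with $\langle\gamma(g),h_{(1)}\rangle\,g h_{(2)}g^{-1}=h_{(1)}\langle\gamma(g),h_{(2)}\rangle$ for all $g\in\Gamma_0$, $h\in H$; - $\lambda:G\times G\to\Gamma_0$ is a normalized 2-cocycle (trivial action), i.e. $\lambda(g_1,g_2)\lambda(g_1g_2,g_3)=\lambda(g_2,g_3)\lambda(g_1,g_2g_3)$ and $\lambda(g,e)=\lambda(e,g)=1$; - $\omega:G^3\to\Bbbk^*$ is a normalized 3-cochain (value $1$ whenever some argument is the identity) such that for all $g_1,g_2,g_3,g_4\in G$ $$\langle\gamma(\lambda(g_1,g_2)),\lambda(g_3,g_4)\rangle=\frac{\omega(g_1,g_2,g_3)\,\omega(g_1,g_2g_3,g_4)\,\omega(g_2,g_3,g_4)}{\omega(g_1g_2,g_3,g_4)\,\omega(g_1,g_2,g_3g_4)}.$$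 *)

theory Defs
  imports "HOL-Algebra.Module" "HOL-Algebra.QuotRing" "HOL-Algebra.Elementary_Groups"
begin

section \<open>Monoid algebras and tensor products\<close>

definition basis_elem :: "('k, 'r) ring_scheme \<Rightarrow> 'a \<Rightarrow> 'a \<Rightarrow> 'k" where
  "basis_elem K x = (\<lambda>y. if y = x then \<one>\<^bsub>K\<^esub> else \<zero>\<^bsub>K\<^esub>)"

definition supp :: "('k, 'r) ring_scheme \<Rightarrow> ('a \<Rightarrow> 'k) \<Rightarrow> 'a set" where
  "supp K u = {x. u x \<noteq> \<zero>\<^bsub>K\<^esub>}"

text \<open>The underlying module is the free module on \<^term>\<open>carrier M\<close>: functions with finite support
  inside \<^term>\<open>carrier M\<close>. The multiplication is the bilinear extension of that of \<open>M\<close>.\<close>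

definition monoid_algebra ::
    "('k, 'r) ring_scheme \<Rightarrow> ('a, 'm) monoid_scheme \<Rightarrow> ('k, 'a \<Rightarrow> 'k) module" where
  "monoid_algebra K M =
    \<lparr>carrier = {u. range u \<subseteq> carrier K \<and> finite (supp K u) \<and> supp K u \<subseteq> carrier M},
     mult = (\<lambda>u v z. \<Oplus>\<^bsub>K\<^esub>p \<in> {p \<in> supp K u \<times> supp K v. fst p \<otimes>\<^bsub>M\<^esub> snd p = z}.
                        u (fst p) \<otimes>\<^bsub>K\<^esub> v (snd p)),
     one = basis_elem K \<one>\<^bsub>M\<^esub>,
     zero = (\<lambda>_. \<zero>\<^bsub>K\<^esub>),
     add = (\<lambda>u v z. u z \<oplus>\<^bsub>K\<^esub> v z),
     smult = (\<lambda>a u z. a \<otimes>\<^bsub>K\<^esub> u z)\<rparr>"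

text \<open>\<open>M \<otimes> N\<close> is the free module on \<^term>\<open>carrier M \<times> carrier N\<close>
  modulo the submodule generated by the bilinearity relations. Using the monoid algebra of
  \<^term>\<open>M \<times>\<times> N\<close> as the free module, the quotient inherits
  \<open>(a \<otimes> b) (c \<otimes> d) = a c \<otimes> b d\<close>, as the submodule is an ideal when \<open>M\<close> and \<open>N\<close> are algebras.\<close>

definition tensor_free :: "('k, 'r) ring_scheme \<Rightarrow> ('k, 'a, 'm) module_scheme \<Rightarrow>
    ('k, 'b, 'n) module_scheme \<Rightarrow> ('k, 'a \<times> 'b \<Rightarrow> 'k) module" where
  "tensor_free K M N = monoid_algebra K (M \<times>\<times> N)"

definition tensor_relations :: "('k, 'r) ring_scheme \<Rightarrow> ('k, 'a, 'm) module_scheme \<Rightarrow>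
    ('k, 'b, 'n) module_scheme \<Rightarrow> ('a \<times> 'b \<Rightarrow> 'k) set" where
  "tensor_relations K M N =
    (let F = tensor_free K M N; \<delta> = (\<lambda>x y. basis_elem K (x, y)) in
      {\<delta> (x \<oplus>\<^bsub>M\<^esub> x') y \<ominus>\<^bsub>F\<^esub> (\<delta> x y \<oplus>\<^bsub>F\<^esub> \<delta> x' y) | x x' y.
          x \<in> carrier M \<and> x' \<in> carrier M \<and> y \<in> carrier N}
    \<union> {\<delta> x (y \<oplus>\<^bsub>N\<^esub> y') \<ominus>\<^bsub>F\<^esub> (\<delta> x y \<oplus>\<^bsub>F\<^esub> \<delta> x y') | x y y'.
          x \<in> carrier M \<and> y \<in> carrier N \<and> y' \<in> carrier N}
    \<union> {\<delta> (a \<odot>\<^bsub>M\<^esub> x) y \<ominus>\<^bsub>F\<^esub> (a \<odot>\<^bsub>F\<^esub> \<delta> x y) | a x y.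
          a \<in> carrier K \<and> x \<in> carrier M \<and> y \<in> carrier N}
    \<union> {\<delta> x (a \<odot>\<^bsub>N\<^esub> y) \<ominus>\<^bsub>F\<^esub> (a \<odot>\<^bsub>F\<^esub> \<delta> x y) | a x y.
          a \<in> carrier K \<and> x \<in> carrier M \<and> y \<in> carrier N})"

definition tensor_null :: "('k, 'r) ring_scheme \<Rightarrow> ('k, 'a, 'm) module_scheme \<Rightarrow>
    ('k, 'b, 'n) module_scheme \<Rightarrow> ('a \<times> 'b \<Rightarrow> 'k) set" where
  "tensor_null K M N =
    \<Inter> {U. submodule U K (tensor_free K M N) \<and> tensor_relations K M N \<subseteq> U}"

definition tensor :: "('k, 'r) ring_scheme \<Rightarrow> ('k, 'a, 'm) module_scheme \<Rightarrow>
    ('k, 'b, 'n) module_scheme \<Rightarrow> ('k, ('a \<times> 'b \<Rightarrow> 'k) set) module" where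
  "tensor K M N =
    (let F = tensor_free K M N; I = tensor_null K M N in
      ring.extend (F Quot I) \<lparr>smult = (\<lambda>a t. \<Union>u\<in>t. I +>\<^bsub>F\<^esub> (a \<odot>\<^bsub>F\<^esub> u))\<rparr>)"

definition pure_tensor :: "('k, 'r) ring_scheme \<Rightarrow> ('k, 'a, 'm) module_scheme \<Rightarrow>
    ('k, 'b, 'n) module_scheme \<Rightarrow> 'a \<Rightarrow> 'b \<Rightarrow> ('a \<times> 'b \<Rightarrow> 'k) set" where
  "pure_tensor K M N x y = tensor_null K M N +>\<^bsub>tensor_free K M N\<^esub> basis_elem K (x, y)"

text \<open>For bilinear \<open>\<beta>\<close>, this is the value at the tensor \<open>t\<close> of the linear map
  \<open>x \<otimes> y \<mapsto> \<beta> x y\<close> into the module \<open>P\<close>; by bilinearity the chosen representative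
  is irrelevant. In Sweedler notation, \<open>tensor_lift K P \<beta> (comult H h)\<close> is
  \<open>\<beta> h\<^sub>(\<^sub>1\<^sub>) h\<^sub>(\<^sub>2\<^sub>)\<close>.\<close>

definition tensor_lift :: "('k, 'r) ring_scheme \<Rightarrow> ('k, 'p, 'm) module_scheme \<Rightarrow>
    ('a \<Rightarrow> 'b \<Rightarrow> 'p) \<Rightarrow> ('a \<times> 'b \<Rightarrow> 'k) set \<Rightarrow> 'p" where
  "tensor_lift K P \<beta> t =
    (let u = (SOME u. u \<in> t) in \<Oplus>\<^bsub>P\<^esub>p \<in> supp K u. u p \<odot>\<^bsub>P\<^esub> \<beta> (fst p) (snd p))"

section \<open>Hopf algebras\<close>

definition self_algebra :: "('k, 'r) ring_scheme \<Rightarrow> ('k, 'k) module" where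
  "self_algebra K = \<lparr>carrier = carrier K, mult = mult K, one = one K, zero = zero K,
     add = add K, smult = mult K\<rparr>"

text \<open>The library's \<^locale>\<open>algebra\<close> is commutative.\<close>

locale assoc_algebra = module K A + ring A for K and A (structure) +
  assumes smult_mult_left: "\<lbrakk>a \<in> carrier K; x \<in> carrier A; y \<in> carrier A\<rbrakk> \<Longrightarrow>
      (a \<odot>\<^bsub>A\<^esub> x) \<otimes>\<^bsub>A\<^esub> y = a \<odot>\<^bsub>A\<^esub> (x \<otimes>\<^bsub>A\<^esub> y)"
    and smult_mult_right: "\<lbrakk>a \<in> carrier K; x \<in> carrier A; y \<in> carrier A\<rbrakk> \<Longrightarrow>
      x \<otimes>\<^bsub>A\<^esub> (a \<odot>\<^bsub>A\<^esub> y) = a \<odot>\<^bsub>A\<^esub> (x \<otimes>\<^bsub>A\<^esub> y)"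

definition lin_maps :: "('k, 'r) ring_scheme \<Rightarrow> ('k, 'a, 'm) module_scheme \<Rightarrow>
    ('k, 'b, 'n) module_scheme \<Rightarrow> ('a \<Rightarrow> 'b) set" where
  "lin_maps K M N = {f \<in> carrier M \<rightarrow> carrier N.
     (\<forall>x\<in>carrier M. \<forall>y\<in>carrier M. f (x \<oplus>\<^bsub>M\<^esub> y) = f x \<oplus>\<^bsub>N\<^esub> f y) \<and>
     (\<forall>a\<in>carrier K. \<forall>x\<in>carrier M. f (a \<odot>\<^bsub>M\<^esub> x) = a \<odot>\<^bsub>N\<^esub> f x)}"

definition alg_hom :: "('k, 'r) ring_scheme \<Rightarrow> ('k, 'a, 'm) module_scheme \<Rightarrow>
    ('k, 'b, 'n) module_scheme \<Rightarrow> ('a \<Rightarrow> 'b) set" where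
  "alg_hom K A B = ring_hom A B \<inter> lin_maps K A B"

record ('k, 'h) hopf = "('k, 'h) module" +
  comult :: "'h \<Rightarrow> ('h \<times> 'h \<Rightarrow> 'k) set"
  counit :: "'h \<Rightarrow> 'k"
  antipode :: "'h \<Rightarrow> 'h"

text \<open>In \<open>coassoc\<close>, both sides lie in \<open>H \<otimes> (H \<otimes> H)\<close>: the reassociation of
  \<open>(\<Delta> \<otimes> id) \<Delta> h\<close> is built into the left-hand side.\<close>

locale hopf_algebra = field K + assoc_algebra K H
  for K :: "('k, 'r) ring_scheme" (structure) and H :: "('k, 'h) hopf" (structure) +
  assumes comult_alg_hom: "comult H \<in> alg_hom K H (tensor K H H)"
    and counit_alg_hom: "counit H \<in> alg_hom K H (self_algebra K)"
    and antipode_linear: "antipode H \<in> lin_maps K H H"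
    and coassoc: "h \<in> carrier H \<Longrightarrow>
      (let HH = tensor K H H; HHH = tensor K H HH in
        tensor_lift K HHH
          (\<lambda>x y. tensor_lift K HHH
             (\<lambda>x\<^sub>1 x\<^sub>2. pure_tensor K H HH x\<^sub>1 (pure_tensor K H H x\<^sub>2 y)) (comult H x))
          (comult H h)
      = tensor_lift K HHH (\<lambda>x y. pure_tensor K H HH x (comult H y)) (comult H h))"
    and counit_left: "h \<in> carrier H \<Longrightarrow>
      tensor_lift K H (\<lambda>x y. counit H x \<odot>\<^bsub>H\<^esub> y) (comult H h) = h"
    and counit_right: "h \<in> carrier H \<Longrightarrow>
      tensor_lift K H (\<lambda>x y. counit H y \<odot>\<^bsub>H\<^esub> x) (comult H h) = h"
    and antipode_left: "h \<in> carrier H \<Longrightarrow>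
      tensor_lift K H (\<lambda>x y. antipode H x \<otimes>\<^bsub>H\<^esub> y) (comult H h) = counit H h \<odot>\<^bsub>H\<^esub> \<one>\<^bsub>H\<^esub>"
    and antipode_right: "h \<in> carrier H \<Longrightarrow>
      tensor_lift K H (\<lambda>x y. x \<otimes>\<^bsub>H\<^esub> antipode H y) (comult H h) = counit H h \<odot>\<^bsub>H\<^esub> \<one>\<^bsub>H\<^esub>"

definition hopf_hom :: "('k, 'r) ring_scheme \<Rightarrow> ('k, 'a) hopf \<Rightarrow> ('k, 'b) hopf \<Rightarrow> ('a \<Rightarrow> 'b) set" where
  "hopf_hom K A B = {f \<in> alg_hom K A B. \<forall>h\<in>carrier A.
      comult B (f h) = tensor_lift K (tensor K B B) (\<lambda>x y. pure_tensor K B B (f x) (f y)) (comult A h)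
    \<and> counit B (f h) = counit A h
    \<and> antipode B (f h) = f (antipode A h)}"

definition group_algebra :: "('k, 'r) ring_scheme \<Rightarrow> ('g, 'm) monoid_scheme \<Rightarrow> ('k, 'g \<Rightarrow> 'k) hopf" where
  "group_algebra K G = (let A = monoid_algebra K G in
    module.extend A
      \<lparr>comult = (\<lambda>u. \<Oplus>\<^bsub>tensor K A A\<^esub>g \<in> supp K u.
                     u g \<odot>\<^bsub>tensor K A A\<^esub> pure_tensor K A A (basis_elem K g) (basis_elem K g)),
       counit = (\<lambda>u. \<Oplus>\<^bsub>K\<^esub>g \<in> supp K u. u g),
       antipode = (\<lambda>u. \<Oplus>\<^bsub>A\<^esub>g \<in> supp K u. u g \<odot>\<^bsub>A\<^esub> basis_elem K (inv\<^bsub>G\<^esub> g))\<rparr>)"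

text \<open>The group-like elements of \<open>H\<close> lying in \<open>A\<close>. When \<open>A\<close> is a Hopf subalgebra this is \<open>G(A)\<close>:
  over a field \<open>A \<otimes> A\<close> embeds into \<open>H \<otimes> H\<close>, so an element of \<open>A\<close> is group-like
  in \<open>A\<close> if and only if it is so in \<open>H\<close>.\<close>

definition grouplikes :: "('k, 'r) ring_scheme \<Rightarrow> ('k, 'h) hopf \<Rightarrow> 'h set \<Rightarrow> 'h monoid" where
  "grouplikes K H A =
    \<lparr>carrier = {g \<in> A. comult H g = pure_tensor K H H g g \<and> counit H g = \<one>\<^bsub>K\<^esub>},
     mult = mult H, one = \<one>\<^bsub>H\<^esub>\<rparr>"

text \<open>Algebra maps \<open>H \<rightarrow> \<k>\<close> are made extensional so that they are equal if and only if they
  agree on \<^term>\<open>carrier H\<close>.\<close>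

definition characters :: "('k, 'r) ring_scheme \<Rightarrow> ('k, 'h) hopf \<Rightarrow> ('h \<Rightarrow> 'k) monoid" where
  "characters K H =
    \<lparr>carrier = alg_hom K H (self_algebra K) \<inter> extensional (carrier H),
     mult = (\<lambda>\<chi> \<psi>. \<lambda>h\<in>carrier H.
       tensor_lift K (self_algebra K) (\<lambda>x y. \<chi> x \<otimes>\<^bsub>K\<^esub> \<psi> y) (comult H h)),
     one = restrict (counit H) (carrier H)\<rparr>"

section \<open>Zesting data\<close>

definition cocentral :: "('k, 'r) ring_scheme \<Rightarrow> ('k, 'h) hopf \<Rightarrow> ('k, 'b) hopf \<Rightarrow> ('h \<Rightarrow> 'b) \<Rightarrow> bool" where
  "cocentral K H B \<pi> \<longleftrightarrow> (\<forall>h\<in>carrier H.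
      tensor_lift K (tensor K H B) (\<lambda>x y. pure_tensor K H B x (\<pi> y)) (comult H h)
    = tensor_lift K (tensor K H B) (\<lambda>x y. pure_tensor K H B y (\<pi> x)) (comult H h))"

definition coinvariants :: "('k, 'r) ring_scheme \<Rightarrow> ('k, 'h) hopf \<Rightarrow> ('k, 'b) hopf \<Rightarrow> ('h \<Rightarrow> 'b) \<Rightarrow> 'h set" where
  "coinvariants K H B \<pi> = {h \<in> carrier H.
      tensor_lift K (tensor K B H) (\<lambda>x y. pure_tensor K B H (\<pi> x) y) (comult H h)
    = pure_tensor K B H \<one>\<^bsub>B\<^esub> h}"

definition zesting_compatible :: "('k, 'r) ring_scheme \<Rightarrow> ('k, 'h) hopf \<Rightarrow> 'h set \<Rightarrow> ('h \<Rightarrow> 'h \<Rightarrow> 'k) \<Rightarrow> bool" where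
  "zesting_compatible K H \<Gamma>\<^sub>0 \<gamma> \<longleftrightarrow> (\<forall>g\<in>\<Gamma>\<^sub>0. \<forall>h\<in>carrier H.
      tensor_lift K H (\<lambda>x y. \<gamma> g x \<odot>\<^bsub>H\<^esub> (g \<otimes>\<^bsub>H\<^esub> y \<otimes>\<^bsub>H\<^esub> inv\<^bsub>H\<^esub> g)) (comult H h)
    = tensor_lift K H (\<lambda>x y. \<gamma> g y \<odot>\<^bsub>H\<^esub> x) (comult H h))"

locale zesting_setting = hopf_algebra K H + G: group G
  for K :: "('k, 'r) ring_scheme" and H :: "('k, 'h) hopf" and G :: "('g, 'm) monoid_scheme" +
  fixes \<pi> :: "'h \<Rightarrow> 'g \<Rightarrow> 'k" and \<Gamma>\<^sub>0 :: "'h set"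
  assumes \<pi>_hopf_hom: "\<pi> \<in> hopf_hom K H (group_algebra K G)"
    and \<pi>_surj: "\<pi> ` carrier H = carrier (group_algebra K G)"
    and \<pi>_cocentral: "cocentral K H (group_algebra K G) \<pi>"
    and \<Gamma>\<^sub>0_subgroup: "subgroup \<Gamma>\<^sub>0 (grouplikes K H (coinvariants K H (group_algebra K G) \<pi>))"

locale associative_zesting_datum = zesting_setting K H G \<pi> \<Gamma>\<^sub>0
  for K :: "('k, 'r) ring_scheme" and H :: "('k, 'h) hopf" and G :: "('g, 'm) monoid_scheme"
    and \<pi> \<Gamma>\<^sub>0 +
  fixes \<gamma> :: "'h \<Rightarrow> 'h \<Rightarrow> 'k" and lam :: "'g \<Rightarrow> 'g \<Rightarrow> 'h" and \<omega> :: "'g \<Rightarrow> 'g \<Rightarrow> 'g \<Rightarrow> 'k"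
  assumes \<gamma>_hom: "\<gamma> \<in> hom ((grouplikes K H (coinvariants K H (group_algebra K G) \<pi>))\<lparr>carrier := \<Gamma>\<^sub>0\<rparr>)
                           (characters K H)"
    and \<gamma>_compatible: "zesting_compatible K H \<Gamma>\<^sub>0 \<gamma>"
    and lam_closed: "\<lbrakk>g\<^sub>1 \<in> carrier G; g\<^sub>2 \<in> carrier G\<rbrakk> \<Longrightarrow> lam g\<^sub>1 g\<^sub>2 \<in> \<Gamma>\<^sub>0"
    and lam_cocycle: "\<lbrakk>g\<^sub>1 \<in> carrier G; g\<^sub>2 \<in> carrier G; g\<^sub>3 \<in> carrier G\<rbrakk> \<Longrightarrow>
        lam g\<^sub>1 g\<^sub>2 \<otimes>\<^bsub>H\<^esub> lam (g\<^sub>1 \<otimes>\<^bsub>G\<^esub> g\<^sub>2) g\<^sub>3 = lam g\<^sub>2 g\<^sub>3 \<otimes>\<^bsub>H\<^esub> lam g\<^sub>1 (g\<^sub>2 \<otimes>\<^bsub>G\<^esub> g\<^sub>3)"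
    and lam_normalized: "g \<in> carrier G \<Longrightarrow> lam g \<one>\<^bsub>G\<^esub> = \<one>\<^bsub>H\<^esub> \<and> lam \<one>\<^bsub>G\<^esub> g = \<one>\<^bsub>H\<^esub>"
    and \<omega>_closed: "\<lbrakk>g\<^sub>1 \<in> carrier G; g\<^sub>2 \<in> carrier G; g\<^sub>3 \<in> carrier G\<rbrakk> \<Longrightarrow> \<omega> g\<^sub>1 g\<^sub>2 g\<^sub>3 \<in> Units K"
    and \<omega>_normalized: "\<lbrakk>g\<^sub>1 \<in> carrier G; g\<^sub>2 \<in> carrier G; g\<^sub>3 \<in> carrier G;
        g\<^sub>1 = \<one>\<^bsub>G\<^esub> \<or> g\<^sub>2 = \<one>\<^bsub>G\<^esub> \<or> g\<^sub>3 = \<one>\<^bsub>G\<^esub>\<rbrakk> \<Longrightarrow> \<omega> g\<^sub>1 g\<^sub>2 g\<^sub>3 = \<one>\<^bsub>K\<^esub>"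
    and \<omega>_lam: "\<lbrakk>g\<^sub>1 \<in> carrier G; g\<^sub>2 \<in> carrier G; g\<^sub>3 \<in> carrier G; g\<^sub>4 \<in> carrier G\<rbrakk> \<Longrightarrow>
        \<gamma> (lam g\<^sub>1 g\<^sub>2) (lam g\<^sub>3 g\<^sub>4)
      = (\<omega> g\<^sub>1 g\<^sub>2 g\<^sub>3 \<otimes>\<^bsub>K\<^esub> \<omega> g\<^sub>1 (g\<^sub>2 \<otimes>\<^bsub>G\<^esub> g\<^sub>3) g\<^sub>4 \<otimes>\<^bsub>K\<^esub> \<omega> g\<^sub>2 g\<^sub>3 g\<^sub>4)
        \<otimes>\<^bsub>K\<^esub> inv\<^bsub>K\<^esub> (\<omega> (g\<^sub>1 \<otimes>\<^bsub>G\<^esub> g\<^sub>2) g\<^sub>3 g\<^sub>4 \<otimes>\<^bsub>K\<^esub> \<omega> g\<^sub>1 g\<^sub>2 (g\<^sub>3 \<otimes>\<^bsub>G\<^esub> g\<^sub>4))"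

text \<open>For \<open>N > 0\<close>, \<^term>\<open>carrier (integer_mod_group N)\<close> is \<^term>\<open>{0..<int N}\<close>.\<close>

definition cyclic_lam :: "('k, 'h) hopf \<Rightarrow> nat \<Rightarrow> 'h \<Rightarrow> int \<Rightarrow> int \<Rightarrow> 'h" where
  "cyclic_lam H N \<nu> i j = (if i + j < int N then \<one>\<^bsub>H\<^esub> else \<nu>)"

definition cyclic_\<omega> :: "('k, 'r) ring_scheme \<Rightarrow> nat \<Rightarrow> 'k \<Rightarrow> int \<Rightarrow> int \<Rightarrow> int \<Rightarrow> 'k" where
  "cyclic_\<omega> K N q i j k = (if i + j < int N then \<one>\<^bsub>K\<^esub> else q [^]\<^bsub>K\<^esub> nat k)"

end

theory Submission
  imports Defs
begin

text \<open>
  The content of the statement is one identity between scalars. Write \<open>c i j\<close> for the carry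
  \<open>(i + j) div N\<close> of the addition of two residues. Then \<open>\<lambda>(i, j) = \<nu>\<^sup>c\<close> and
  \<open>\<omega>(i, j, k) = q\<^sup>c\<^sup>k\<close> with \<open>c = c i j\<close>, and two facts about carries suffice:
  carrying is a 2-cocycle, \<open>c i j + c [i + j] k = c j k + c i [j + k]\<close> where \<open>[x] = x mod N\<close>,
  and \<open>k + l - [k + l] = N (c k l)\<close>. The first is the cocycle condition for \<open>\<lambda>\<close>.
  Together they show that the quotient of values of \<open>\<omega>\<close> required to agree with
  \<open>\<gamma>(\<lambda>(i, j))(\<lambda>(k, l))\<close> is \<open>q\<close> to the power \<open>N (c i j) (c k l)\<close>, that is
  \<open>m\<close> to the power \<open>(c i j) (c k l)\<close>.

  Since each carry is \<open>0\<close> or \<open>1\<close>, it remains to evaluate \<open>\<gamma> g h\<close> for \<open>g, h \<in> {1, \<nu>}\<close>. The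
  characters \<open>\<gamma> g\<close> are unital, so only \<open>\<gamma> 1 \<nu> = 1\<close> needs an argument: \<open>\<gamma> 1\<close> is
  idempotent under convolution, evaluation of characters at a group-like element turns
  convolution into multiplication, and \<open>\<gamma> 1 \<nu>\<close> is a unit because \<open>\<nu>\<close> is invertible. The
  multiplicativity of evaluation is where the construction of the tensor product enters: it must be
  shown that a bilinear map, extended linearly to the free module, does not depend on the
  representative of \<open>\<nu> \<otimes> \<nu>\<close> (\<open>tensor_lift_pure_tensor\<close> below).
\<close>

section \<open>Lifting bilinear maps to the tensor product\<close>

lemma supp_add_subset:
  assumes "cring K"
  shows "supp K (\<lambda>z. u z \<oplus>\<^bsub>K\<^esub> v z) \<subseteq> supp K u \<union> supp K v"
proof -
  interpret cring K by fact
  show ?thesis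
    by (auto simp: supp_def)
qed

lemma monoid_algebra_module:
  assumes "cring K"
  shows "module K (monoid_algebra K M)"
proof -
  interpret cring K by fact
  have val: "u z \<in> carrier K" if "u \<in> carrier (monoid_algebra K M)" for u z
    using that by (auto simp: monoid_algebra_def)
  have add: "(\<lambda>z. u z \<oplus>\<^bsub>K\<^esub> v z) \<in> carrier (monoid_algebra K M)"
    if "u \<in> carrier (monoid_algebra K M)" "v \<in> carrier (monoid_algebra K M)" for u v
  proof -
    have "finite (supp K (\<lambda>z. u z \<oplus>\<^bsub>K\<^esub> v z))"
      using supp_add_subset[OF assms, of u v] that
      by (auto simp: monoid_algebra_def intro: finite_subset)
    then show ?thesis
      using supp_add_subset[OF assms, of u v] that val[OF that(1)] val[OF that(2)]
      by (auto simp: monoid_algebra_def)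
  qed
  have smult: "(\<lambda>z. a \<otimes>\<^bsub>K\<^esub> u z) \<in> carrier (monoid_algebra K M)"
    if "a \<in> carrier K" "u \<in> carrier (monoid_algebra K M)" for a u
  proof -
    have sub: "supp K (\<lambda>z. a \<otimes>\<^bsub>K\<^esub> u z) \<subseteq> supp K u"
      using that by (auto simp: supp_def)
    moreover have "finite (supp K (\<lambda>z. a \<otimes>\<^bsub>K\<^esub> u z))"
      using sub that by (auto simp: monoid_algebra_def intro: finite_subset)
    ultimately show ?thesis
      using that val[OF that(2)] by (auto simp: monoid_algebra_def)
  qed
  have zero: "(\<lambda>_. \<zero>\<^bsub>K\<^esub>) \<in> carrier (monoid_algebra K M)"
    by (auto simp: monoid_algebra_def supp_def)
  have ops: "add (monoid_algebra K M) = (\<lambda>u v z. u z \<oplus>\<^bsub>K\<^esub> v z)"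
    "zero (monoid_algebra K M) = (\<lambda>_. \<zero>\<^bsub>K\<^esub>)"
    "smult (monoid_algebra K M) = (\<lambda>a u z. a \<otimes>\<^bsub>K\<^esub> u z)"
    by (simp_all add: monoid_algebra_def)
  show ?thesis
  proof (rule moduleI)
    show "abelian_group (monoid_algebra K M)"
    proof (rule abelian_groupI)
      fix u assume u: "u \<in> carrier (monoid_algebra K M)"
      have "(\<lambda>z. (\<ominus>\<^bsub>K\<^esub> \<one>\<^bsub>K\<^esub>) \<otimes>\<^bsub>K\<^esub> u z) \<oplus>\<^bsub>monoid_algebra K M\<^esub> u = \<zero>\<^bsub>monoid_algebra K M\<^esub>"
        using val[OF u] by (simp add: ops l_minus l_neg fun_eq_iff)
      then show "\<exists>v\<in>carrier (monoid_algebra K M). v \<oplus>\<^bsub>monoid_algebra K M\<^esub> u = \<zero>\<^bsub>monoid_algebra K M\<^esub>"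
        using smult[OF _ u, of "\<ominus>\<^bsub>K\<^esub> \<one>\<^bsub>K\<^esub>"] by blast
    qed (use add zero val in \<open>auto simp: ops a_ac fun_eq_iff\<close>)
  qed (use smult val in \<open>auto simp: ops l_distr r_distr m_assoc fun_eq_iff is_cring\<close>)
qed

lemma basis_elem_closed:
  assumes "cring K" "x \<in> carrier M"
  shows "basis_elem K x \<in> carrier (monoid_algebra K M)"
proof -
  interpret cring K by fact
  have "supp K (basis_elem K x) \<subseteq> {x}"
    by (auto simp: supp_def basis_elem_def)
  then show ?thesis
    using assms(2) by (auto simp: monoid_algebra_def basis_elem_def intro: finite_subset)
qed

locale bilinear_map =
  M: abelian_group M + N: abelian_group N + P: module K P
  for K :: "('k, 'r) ring_scheme" and M :: "('k, 'a, 'm) module_scheme"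
    and N :: "('k, 'b, 'n) module_scheme" and P :: "('k, 'p, 'q) module_scheme" +
  fixes \<beta> :: "'a \<Rightarrow> 'b \<Rightarrow> 'p"
  assumes M_smult: "\<lbrakk>a \<in> carrier K; x \<in> carrier M\<rbrakk> \<Longrightarrow> a \<odot>\<^bsub>M\<^esub> x \<in> carrier M"
    and N_smult: "\<lbrakk>a \<in> carrier K; y \<in> carrier N\<rbrakk> \<Longrightarrow> a \<odot>\<^bsub>N\<^esub> y \<in> carrier N"
    and closed: "\<lbrakk>x \<in> carrier M; y \<in> carrier N\<rbrakk> \<Longrightarrow> \<beta> x y \<in> carrier P"
    and add_left: "\<lbrakk>x \<in> carrier M; x' \<in> carrier M; y \<in> carrier N\<rbrakk> \<Longrightarrow>
      \<beta> (x \<oplus>\<^bsub>M\<^esub> x') y = \<beta> x y \<oplus>\<^bsub>P\<^esub> \<beta> x' y"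
    and add_right: "\<lbrakk>x \<in> carrier M; y \<in> carrier N; y' \<in> carrier N\<rbrakk> \<Longrightarrow>
      \<beta> x (y \<oplus>\<^bsub>N\<^esub> y') = \<beta> x y \<oplus>\<^bsub>P\<^esub> \<beta> x y'"
    and smult_left: "\<lbrakk>a \<in> carrier K; x \<in> carrier M; y \<in> carrier N\<rbrakk> \<Longrightarrow>
      \<beta> (a \<odot>\<^bsub>M\<^esub> x) y = a \<odot>\<^bsub>P\<^esub> \<beta> x y"
    and smult_right: "\<lbrakk>a \<in> carrier K; x \<in> carrier M; y \<in> carrier N\<rbrakk> \<Longrightarrow>
      \<beta> x (a \<odot>\<^bsub>N\<^esub> y) = a \<odot>\<^bsub>P\<^esub> \<beta> x y"
begin

definition free_ext :: "('a \<times> 'b \<Rightarrow> 'k) \<Rightarrow> 'p" where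
  "free_ext u = (\<Oplus>\<^bsub>P\<^esub>p \<in> supp K u. u p \<odot>\<^bsub>P\<^esub> \<beta> (fst p) (snd p))"

abbreviation F where "F \<equiv> tensor_free K M N"

sublocale F: module K F
  unfolding tensor_free_def by (rule monoid_algebra_module) (rule P.is_cring)

lemma F_ops:
  "u \<oplus>\<^bsub>F\<^esub> v = (\<lambda>z. u z \<oplus>\<^bsub>K\<^esub> v z)" "a \<odot>\<^bsub>F\<^esub> u = (\<lambda>z. a \<otimes>\<^bsub>K\<^esub> u z)"
  by (simp_all add: tensor_free_def monoid_algebra_def)

lemma F_D:
  assumes "u \<in> carrier F"
  shows "u z \<in> carrier K" "finite (supp K u)" "supp K u \<subseteq> carrier M \<times> carrier N"
  using assms by (auto simp: tensor_free_def monoid_algebra_def)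

lemma term_closed:
  assumes "u \<in> carrier F" "S \<subseteq> carrier M \<times> carrier N"
  shows "(\<lambda>p. u p \<odot>\<^bsub>P\<^esub> \<beta> (fst p) (snd p)) \<in> S \<rightarrow> carrier P"
  using assms F_D(1) by (auto intro!: P.smult_closed closed)

text \<open>Sums for different elements of the free module have different index sets; enlarging them to
  a common one makes the linearity of the extension a termwise statement.\<close>

lemma free_ext_superset:
  assumes u: "u \<in> carrier F" and S: "finite S" "supp K u \<subseteq> S" "S \<subseteq> carrier M \<times> carrier N"
  shows "free_ext u = (\<Oplus>\<^bsub>P\<^esub>p \<in> S. u p \<odot>\<^bsub>P\<^esub> \<beta> (fst p) (snd p))"
  unfolding free_ext_def
proof (rule P.M.add.finprod_mono_neutral_cong_left)
  show "u p \<odot>\<^bsub>P\<^esub> \<beta> (fst p) (snd p) = \<zero>\<^bsub>P\<^esub>" if "p \<in> S - supp K u" for p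
  proof -
    from that S(3) have "\<beta> (fst p) (snd p) \<in> carrier P"
      by (auto intro!: closed)
    then show ?thesis
      using that by (simp add: supp_def)
  qed
qed (use S term_closed[OF u S(3)] in auto)

lemma free_ext_closed:
  assumes "u \<in> carrier F"
  shows "free_ext u \<in> carrier P"
  unfolding free_ext_def by (rule P.M.finsum_closed) (rule term_closed[OF assms F_D(3)[OF assms]])

lemma free_ext_add:
  assumes u: "u \<in> carrier F" and v: "v \<in> carrier F"
  shows "free_ext (u \<oplus>\<^bsub>F\<^esub> v) = free_ext u \<oplus>\<^bsub>P\<^esub> free_ext v"
proof -
  let ?S = "supp K u \<union> supp K v"
  let ?t = "\<lambda>u p. u p \<odot>\<^bsub>P\<^esub> \<beta> (fst p) (snd p)"
  have S: "finite ?S" "?S \<subseteq> carrier M \<times> carrier N"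
    using F_D[OF u] F_D[OF v] by auto
  have "supp K (u \<oplus>\<^bsub>F\<^esub> v) \<subseteq> ?S"
    by (auto simp: F_ops supp_def)
  then have "free_ext (u \<oplus>\<^bsub>F\<^esub> v) = finsum P (?t (u \<oplus>\<^bsub>F\<^esub> v)) ?S"
    using S by (intro free_ext_superset F.M.a_closed u v)
  also have "\<dots> = (\<Oplus>\<^bsub>P\<^esub>p \<in> ?S. ?t u p \<oplus>\<^bsub>P\<^esub> ?t v p)"
  proof (rule P.M.finsum_cong')
    show "(\<lambda>p. ?t u p \<oplus>\<^bsub>P\<^esub> ?t v p) \<in> ?S \<rightarrow> carrier P"
      using term_closed[OF u S(2)] term_closed[OF v S(2)] by (auto intro!: P.M.a_closed)
    show "?t (u \<oplus>\<^bsub>F\<^esub> v) p = ?t u p \<oplus>\<^bsub>P\<^esub> ?t v p" if "p \<in> ?S" for p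
    proof -
      from that S(2) have "\<beta> (fst p) (snd p) \<in> carrier P"
        by (auto intro!: closed)
      then show ?thesis
        by (simp add: F_ops P.smult_l_distr F_D(1)[OF u] F_D(1)[OF v])
    qed
  qed simp
  also have "\<dots> = finsum P (?t u) ?S \<oplus>\<^bsub>P\<^esub> finsum P (?t v) ?S"
    by (rule P.M.finsum_addf) (rule term_closed[OF u S(2)], rule term_closed[OF v S(2)])
  also have "\<dots> = free_ext u \<oplus>\<^bsub>P\<^esub> free_ext v"
    using S by (simp add: free_ext_superset[OF u, of ?S] free_ext_superset[OF v, of ?S])
  finally show ?thesis .
qed

lemma free_ext_smult:
  assumes a: "a \<in> carrier K" and u: "u \<in> carrier F"
  shows "free_ext (a \<odot>\<^bsub>F\<^esub> u) = a \<odot>\<^bsub>P\<^esub> free_ext u"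
proof -
  let ?t = "\<lambda>u p. u p \<odot>\<^bsub>P\<^esub> \<beta> (fst p) (snd p)"
  have "supp K (a \<odot>\<^bsub>F\<^esub> u) \<subseteq> supp K u"
    using a by (auto simp: F_ops supp_def)
  then have "free_ext (a \<odot>\<^bsub>F\<^esub> u) = finsum P (?t (a \<odot>\<^bsub>F\<^esub> u)) (supp K u)"
    using F_D[OF u] by (intro free_ext_superset F.smult_closed a u)
  also have "\<dots> = (\<Oplus>\<^bsub>P\<^esub>p \<in> supp K u. a \<odot>\<^bsub>P\<^esub> ?t u p)"
  proof (rule P.M.finsum_cong')
    show "(\<lambda>p. a \<odot>\<^bsub>P\<^esub> ?t u p) \<in> supp K u \<rightarrow> carrier P"
      by (rule Pi_I, rule P.smult_closed[OF a], rule funcset_mem[OF term_closed[OF u F_D(3)[OF u]]])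
    show "?t (a \<odot>\<^bsub>F\<^esub> u) p = a \<odot>\<^bsub>P\<^esub> ?t u p" if "p \<in> supp K u" for p
    proof -
      from that F_D(3)[OF u] have "\<beta> (fst p) (snd p) \<in> carrier P"
        by (auto intro!: closed)
      then show ?thesis
        by (simp add: F_ops P.smult_assoc1 F_D(1)[OF u] a)
    qed
  qed simp
  also have "\<dots> = a \<odot>\<^bsub>P\<^esub> free_ext u"
    unfolding free_ext_def
    by (rule P.finsum_smult_ldistr[symmetric, OF F_D(2)[OF u] a term_closed[OF u F_D(3)[OF u]]])
  finally show ?thesis .
qed

lemma free_ext_minus:
  assumes u: "u \<in> carrier F" and v: "v \<in> carrier F" and eq: "free_ext u = free_ext v"
  shows "free_ext (u \<ominus>\<^bsub>F\<^esub> v) = \<zero>\<^bsub>P\<^esub>"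
proof -
  have "u \<ominus>\<^bsub>F\<^esub> v = u \<oplus>\<^bsub>F\<^esub> (\<ominus>\<^bsub>K\<^esub> \<one>\<^bsub>K\<^esub>) \<odot>\<^bsub>F\<^esub> v"
    using v by (simp add: a_minus_def F.smult_l_minus)
  then show ?thesis
    using u v free_ext_closed[OF v]
    by (simp add: free_ext_add free_ext_smult eq P.smult_l_minus P.M.r_neg)
qed

lemma basis_closed:
  "x \<in> carrier M \<Longrightarrow> y \<in> carrier N \<Longrightarrow> basis_elem K (x, y) \<in> carrier F"
  unfolding tensor_free_def by (rule basis_elem_closed) (auto intro: P.is_cring)

lemma free_ext_basis:
  assumes "x \<in> carrier M" "y \<in> carrier N"
  shows "free_ext (basis_elem K (x, y)) = \<beta> x y"
proof -
  have "free_ext (basis_elem K (x, y)) =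
      (\<Oplus>\<^bsub>P\<^esub>p \<in> {(x, y)}. basis_elem K (x, y) p \<odot>\<^bsub>P\<^esub> \<beta> (fst p) (snd p))"
    using assms by (intro free_ext_superset basis_closed) (auto simp: supp_def basis_elem_def)
  then show ?thesis
    using assms by (simp add: closed basis_elem_def)
qed

text \<open>The kernel of the extension is a submodule, and bilinearity says that it contains the
  generators of the relations.\<close>

lemma free_ext_null:
  assumes "u \<in> tensor_null K M N"
  shows "u \<in> carrier F" "free_ext u = \<zero>\<^bsub>P\<^esub>"
proof -
  let ?W = "{u \<in> carrier F. free_ext u = \<zero>\<^bsub>P\<^esub>}"
  have "submodule ?W K F"
  proof (rule F.submoduleI)
    show "\<zero>\<^bsub>F\<^esub> \<in> ?W"
      using free_ext_smult[of "\<zero>\<^bsub>K\<^esub>" "\<zero>\<^bsub>F\<^esub>"] free_ext_closed[of "\<zero>\<^bsub>F\<^esub>"] by simp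
    then show "\<ominus>\<^bsub>F\<^esub> u \<in> ?W" if "u \<in> ?W" for u
      using free_ext_minus[of "\<zero>\<^bsub>F\<^esub>" u] that by (simp add: a_minus_def)
  qed (auto simp: free_ext_add free_ext_smult)
  moreover have "tensor_relations K M N \<subseteq> ?W"
    unfolding tensor_relations_def Let_def
    by (auto simp: basis_closed free_ext_basis free_ext_add free_ext_smult
        M_smult N_smult closed add_left add_right smult_left smult_right
        intro!: free_ext_minus F.M.minus_closed)
  ultimately have "tensor_null K M N \<subseteq> ?W"
    unfolding tensor_null_def by blast
  then show "u \<in> carrier F" "free_ext u = \<zero>\<^bsub>P\<^esub>"
    using assms by auto
qed

text \<open>The universal property of the tensor product, on pure tensors.\<close>

theorem tensor_lift_pure_tensor:
  assumes xy: "x \<in> carrier M" "y \<in> carrier N"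
  shows "tensor_lift K P \<beta> (pure_tensor K M N x y) = \<beta> x y"
proof -
  let ?b = "basis_elem K (x, y)" and ?t = "pure_tensor K M N x y"
  have t: "?t = (\<Union>n \<in> tensor_null K M N. {n \<oplus>\<^bsub>F\<^esub> ?b})"
    by (simp add: pure_tensor_def a_r_coset_def r_coset_def)
  have "\<zero>\<^bsub>F\<^esub> \<in> tensor_null K M N"
    unfolding tensor_null_def
    using subgroup.one_closed[OF submodule.axioms(1)] by fastforce
  then have "?t \<noteq> {}"
    using t by blast
  then have "(SOME u. u \<in> ?t) \<in> ?t"
    by (simp add: some_in_eq)
  then obtain n where n: "n \<in> tensor_null K M N" "(SOME u. u \<in> ?t) = n \<oplus>\<^bsub>F\<^esub> ?b"
    using t by auto
  have "tensor_lift K P \<beta> ?t = free_ext (n \<oplus>\<^bsub>F\<^esub> ?b)"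
    by (simp add: tensor_lift_def n(2) free_ext_def Let_def)
  also have "\<dots> = \<beta> x y"
    using free_ext_null[OF n(1)] xy by (simp add: free_ext_add basis_closed free_ext_basis closed)
  finally show ?thesis .
qed

end

section \<open>Characters at group-like elements\<close>

lemma self_algebra_module:
  assumes "cring K"
  shows "module K (self_algebra K)"
proof -
  interpret cring K by fact
  show ?thesis
  proof (rule moduleI)
    show "abelian_group (self_algebra K)"
    proof (rule abelian_groupI)
      show "\<exists>y\<in>carrier (self_algebra K). y \<oplus>\<^bsub>self_algebra K\<^esub> x = \<zero>\<^bsub>self_algebra K\<^esub>"
        if "x \<in> carrier (self_algebra K)" for x
        using that l_neg[of x] a_inv_closed[of x] by (auto simp: self_algebra_def)
    qed (auto simp: self_algebra_def a_ac)
  qed (auto simp: self_algebra_def l_distr r_distr m_assoc is_cring)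
qed

context hopf_algebra
begin

lemma character_eval:
  assumes "\<chi> \<in> carrier (characters K H)"
  shows "x \<in> carrier H \<Longrightarrow> \<chi> x \<in> carrier K"
    and "\<lbrakk>x \<in> carrier H; y \<in> carrier H\<rbrakk> \<Longrightarrow> \<chi> (x \<otimes>\<^bsub>H\<^esub> y) = \<chi> x \<otimes>\<^bsub>K\<^esub> \<chi> y"
    and "\<lbrakk>x \<in> carrier H; y \<in> carrier H\<rbrakk> \<Longrightarrow> \<chi> (x \<oplus>\<^bsub>H\<^esub> y) = \<chi> x \<oplus>\<^bsub>K\<^esub> \<chi> y"
    and "\<lbrakk>a \<in> carrier K; x \<in> carrier H\<rbrakk> \<Longrightarrow> \<chi> (a \<odot>\<^bsub>H\<^esub> x) = a \<otimes>\<^bsub>K\<^esub> \<chi> x"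
    and "\<chi> \<one>\<^bsub>H\<^esub> = \<one>\<^bsub>K\<^esub>"
  using assms
  by (auto simp: characters_def alg_hom_def lin_maps_def ring_hom_def self_algebra_def Pi_def)

lemma convolution_grouplike:
  assumes \<chi>: "\<chi> \<in> carrier (characters K H)" and \<psi>: "\<psi> \<in> carrier (characters K H)"
    and g: "g \<in> carrier H" "comult H g = pure_tensor K H H g g"
  shows "(\<chi> \<otimes>\<^bsub>characters K H\<^esub> \<psi>) g = \<chi> g \<otimes>\<^bsub>K\<^esub> \<psi> g"
proof -
  interpret S: module K "self_algebra K"
    by (rule self_algebra_module) (rule is_cring)
  interpret bilinear_map K H H "self_algebra K" "\<lambda>x y. \<chi> x \<otimes>\<^bsub>K\<^esub> \<psi> y"
    by unfold_locales
      (auto simp: self_algebra_def character_eval[OF \<chi>] character_eval[OF \<psi>]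
        cring.cring_simprules[OF is_cring])
  show ?thesis
    using tensor_lift_pure_tensor[OF g(1) g(1)] g by (simp add: characters_def)
qed

lemma character_unit:
  assumes \<chi>: "\<chi> \<in> carrier (characters K H)"
    and "g \<in> carrier H" "h \<in> carrier H" "g \<otimes>\<^bsub>H\<^esub> h = \<one>\<^bsub>H\<^esub>"
  shows "\<chi> g \<in> Units K"
proof -
  have "\<chi> g \<otimes>\<^bsub>K\<^esub> \<chi> h = \<one>\<^bsub>K\<^esub>"
    using assms(2-) character_eval(2)[OF \<chi>, of g h] character_eval(5)[OF \<chi>] by simp
  moreover have "\<chi> g \<in> carrier K" "\<chi> h \<in> carrier K"
    using character_eval(1)[OF \<chi>] assms(2-) by auto
  ultimately show ?thesis
    unfolding Units_def by (auto intro!: bexI[of _ "\<chi> h"] simp: cring.cring_simprules[OF is_cring])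
qed

text \<open>An idempotent character takes an idempotent unit, hence \<open>1\<close>, as value at every invertible
  group-like element.\<close>

lemma idempotent_character_grouplike:
  assumes \<epsilon>: "\<epsilon> \<in> carrier (characters K H)" and idem: "\<epsilon> \<otimes>\<^bsub>characters K H\<^esub> \<epsilon> = \<epsilon>"
    and g: "g \<in> carrier H" "comult H g = pure_tensor K H H g g"
    and h: "h \<in> carrier H" "g \<otimes>\<^bsub>H\<^esub> h = \<one>\<^bsub>H\<^esub>"
  shows "\<epsilon> g = \<one>\<^bsub>K\<^esub>"
proof -
  have K: "monoid K"
    using is_cring by (simp add: cring_def ring_def)
  have u: "\<epsilon> g \<in> Units K"
    by (rule character_unit[OF \<epsilon> g(1) h])
  have "\<epsilon> g \<otimes>\<^bsub>K\<^esub> \<epsilon> g = \<epsilon> g \<otimes>\<^bsub>K\<^esub> \<one>\<^bsub>K\<^esub>"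
    using convolution_grouplike[OF \<epsilon> \<epsilon> g] idem u
    by (simp add: monoid.r_one[OF K] monoid.Units_closed[OF K])
  then show ?thesis
    using monoid.Units_l_cancel[OF K u] monoid.Units_closed[OF K u] monoid.one_closed[OF K] by blast
qed

end

section \<open>Carries\<close>

definition carry :: "nat \<Rightarrow> int \<Rightarrow> int \<Rightarrow> nat" where
  "carry N i j = (if i + j < int N then 0 else 1)"

lemma mod_add_carry:
  assumes "i \<in> {0..<int N}" "j \<in> {0..<int N}"
  shows "(i + j) mod int N = i + j - int N * int (carry N i j)"
proof (cases "i + j < int N")
  case False
  then have "(i + j) mod int N = (i + j - int N) mod int N"
    by simp
  also have "\<dots> = i + j - int N"
    using False assms by (intro mod_pos_pos_trivial) auto
  finally show ?thesis
    using False by (simp add: carry_def)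
qed (use assms in \<open>simp add: carry_def\<close>)

text \<open>Both sides count how often \<open>N\<close> is carried when three residues are added.\<close>

lemma carry_cocycle:
  assumes "i \<in> {0..<int N}" "j \<in> {0..<int N}" "k \<in> {0..<int N}"
  shows "carry N i j + carry N ((i + j) mod int N) k = carry N j k + carry N i ((j + k) mod int N)"
  using assms by (simp add: mod_add_carry) (auto simp: carry_def)

text \<open>The exponent of \<open>q\<close> in the 3-cochain equation, with the negative terms moved to the other
  side so that all exponents are natural numbers.\<close>

lemma carry_exponents:
  assumes "i \<in> {0..<int N}" "j \<in> {0..<int N}" "k \<in> {0..<int N}" "l \<in> {0..<int N}"
  shows "carry N i j * nat k + carry N i ((j + k) mod int N) * nat l + carry N j k * nat l =
    N * (carry N i j * carry N k l) +
      (carry N ((i + j) mod int N) k * nat l + carry N i j * nat ((k + l) mod int N))"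
proof -
  have "0 \<le> (k + l) mod int N"
    using assms by simp
  then have kl: "int (nat ((k + l) mod int N)) = k + l - int N * int (carry N k l)"
    using mod_add_carry[of k N l] assms by simp
  have coc: "int (carry N i j) + int (carry N ((i + j) mod int N) k) =
      int (carry N j k) + int (carry N i ((j + k) mod int N))"
    using carry_cocycle[of i N j k] assms by (metis of_nat_add)
  have "int (carry N i j) * k + int (carry N i ((j + k) mod int N)) * l + int (carry N j k) * l =
      int (carry N i j) * k + (int (carry N i j) + int (carry N ((i + j) mod int N) k)) * l"
    unfolding coc by (simp add: algebra_simps)
  also have "\<dots> = int N * (int (carry N i j) * int (carry N k l)) +
      (int (carry N ((i + j) mod int N) k) * l +
       int (carry N i j) * (k + l - int N * int (carry N k l)))"
    by (simp add: algebra_simps)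
  finally have "int (carry N i j * nat k + carry N i ((j + k) mod int N) * nat l + carry N j k * nat l) =
    int (N * (carry N i j * carry N k l) +
      (carry N ((i + j) mod int N) k * nat l + carry N i j * nat ((k + l) mod int N)))"
    unfolding of_nat_add of_nat_mult kl using assms by simp
  then show ?thesis
    by (simp only: of_nat_eq_iff)
qed

lemma cyclic_lam_carry:
  assumes "monoid H" "\<nu> \<in> carrier H"
  shows "cyclic_lam H N \<nu> i j = \<nu> [^]\<^bsub>H\<^esub> carry N i j"
proof -
  interpret monoid H by fact
  show ?thesis
    using assms(2) by (simp add: cyclic_lam_def carry_def)
qed

lemma (in monoid) Units_nat_pow_closed: "x \<in> Units G \<Longrightarrow> x [^] (n::nat) \<in> Units G"
  by (induction n) auto

lemma cyclic_\<omega>_carry: "cyclic_\<omega> K N q i j k = q [^]\<^bsub>K\<^esub> (carry N i j * nat k)"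
  by (simp add: cyclic_\<omega>_def carry_def)

lemma (in cring) cyclic_\<omega>_coboundary:
  assumes q: "q \<in> Units R"
    and "i \<in> {0..<int N}" "j \<in> {0..<int N}" "k \<in> {0..<int N}" "l \<in> {0..<int N}"
  shows "(cyclic_\<omega> R N q i j k \<otimes> cyclic_\<omega> R N q i ((j + k) mod int N) l \<otimes> cyclic_\<omega> R N q j k l)
      \<otimes> inv (cyclic_\<omega> R N q ((i + j) mod int N) k l \<otimes> cyclic_\<omega> R N q i j ((k + l) mod int N))
    = (q [^] N) [^] (carry N i j * carry N k l)"
proof -
  let ?d = "carry N ((i + j) mod int N) k * nat l + carry N i j * nat ((k + l) mod int N)"
  have qc: "q \<in> carrier R"
    using q by blast
  have d: "q [^] ?d \<in> Units R"
    using q by (rule Units_nat_pow_closed)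
  have "cyclic_\<omega> R N q i j k \<otimes> cyclic_\<omega> R N q i ((j + k) mod int N) l \<otimes> cyclic_\<omega> R N q j k l
      = q [^] (N * (carry N i j * carry N k l)) \<otimes> q [^] ?d"
    using carry_exponents[OF assms(2-)] qc by (simp add: cyclic_\<omega>_carry nat_pow_mult)
  moreover have "cyclic_\<omega> R N q ((i + j) mod int N) k l \<otimes> cyclic_\<omega> R N q i j ((k + l) mod int N) = q [^] ?d"
    using qc by (simp add: cyclic_\<omega>_carry nat_pow_mult)
  ultimately show ?thesis
    using d qc by (simp add: m_assoc nat_pow_pow)
qed

section \<open>The cyclic zesting datum\<close>

theorem proposition4p5:
  fixes K :: "('k, 'r) ring_scheme" and H :: "('k, 'h) hopf" and N :: nat
    and \<pi> :: "'h \<Rightarrow> int \<Rightarrow> 'k" and \<Gamma>\<^sub>0 :: "'h set"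
    and \<gamma> :: "'h \<Rightarrow> 'h \<Rightarrow> 'k" and \<nu> :: 'h and m :: 'k
  defines "B \<equiv> group_algebra K (integer_mod_group N)"
  defines "GH \<equiv> grouplikes K H (coinvariants K H B \<pi>)"
  assumes "hopf_algebra K H" and "N \<ge> 1"
    and "\<pi> \<in> hopf_hom K H B" and "\<pi> ` carrier H = carrier B" and "cocentral K H B \<pi>"
    and "subgroup \<Gamma>\<^sub>0 GH" and "comm_group (GH\<lparr>carrier := \<Gamma>\<^sub>0\<rparr>)"
    and "\<gamma> \<in> hom (GH\<lparr>carrier := \<Gamma>\<^sub>0\<rparr>) (characters K H)"
    and "zesting_compatible K H \<Gamma>\<^sub>0 \<gamma>"
    and "\<nu> \<in> \<Gamma>\<^sub>0" and "m = \<gamma> \<nu> \<nu>"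
  shows "m \<in> Units K \<and>
    (\<forall>q \<in> Units K. q [^]\<^bsub>K\<^esub> N = m \<longrightarrow>
      associative_zesting_datum K H (integer_mod_group N) \<pi> \<Gamma>\<^sub>0 \<gamma> (cyclic_lam H N \<nu>) (cyclic_\<omega> K N q))"
proof -
  interpret hopf_algebra K H by fact
  interpret \<Gamma>: comm_group "GH\<lparr>carrier := \<Gamma>\<^sub>0\<rparr>" by fact
  have H_monoid: "monoid H" ..
  have K_monoid: "monoid K"
    using is_cring by (simp add: cring_def ring_def)
  have GH_simps: "mult GH = mult H" "one GH = \<one>\<^bsub>H\<^esub>"
    by (simp_all add: GH_def grouplikes_def)
  have \<Gamma>_grouplike: "g \<in> carrier H \<and> comult H g = pure_tensor K H H g g" if "g \<in> \<Gamma>\<^sub>0" for g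
    using subgroup.subset[OF \<open>subgroup \<Gamma>\<^sub>0 GH\<close>] that
    by (auto simp: GH_def grouplikes_def coinvariants_def)
  have one: "\<one>\<^bsub>H\<^esub> \<in> \<Gamma>\<^sub>0"
    using \<Gamma>.one_closed by (simp add: GH_simps)
  have \<nu>: "\<nu> \<in> carrier H" "comult H \<nu> = pure_tensor K H H \<nu> \<nu>"
    using \<Gamma>_grouplike[OF \<open>\<nu> \<in> \<Gamma>\<^sub>0\<close>] by auto
  obtain \<nu>' where \<nu>': "\<nu>' \<in> carrier H" "\<nu> \<otimes>\<^bsub>H\<^esub> \<nu>' = \<one>\<^bsub>H\<^esub>"
    using \<Gamma>.r_inv_ex[of \<nu>] \<open>\<nu> \<in> \<Gamma>\<^sub>0\<close> \<Gamma>_grouplike by (auto simp: GH_simps)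
  have \<gamma>_char: "\<gamma> g \<in> carrier (characters K H)" if "g \<in> \<Gamma>\<^sub>0" for g
    using \<open>\<gamma> \<in> hom _ _\<close> that by (auto simp: hom_def)
  have "\<gamma> (\<one>\<^bsub>H\<^esub> \<otimes>\<^bsub>GH\<lparr>carrier := \<Gamma>\<^sub>0\<rparr>\<^esub> \<one>\<^bsub>H\<^esub>) = \<gamma> \<one>\<^bsub>H\<^esub> \<otimes>\<^bsub>characters K H\<^esub> \<gamma> \<one>\<^bsub>H\<^esub>"
    by (rule hom_mult[OF \<open>\<gamma> \<in> hom _ _\<close>]) (simp_all add: one)
  then have \<gamma>_one_idem: "\<gamma> \<one>\<^bsub>H\<^esub> \<otimes>\<^bsub>characters K H\<^esub> \<gamma> \<one>\<^bsub>H\<^esub> = \<gamma> \<one>\<^bsub>H\<^esub>"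
    by (simp add: GH_simps)
  have \<gamma>_one: "\<gamma> \<one>\<^bsub>H\<^esub> \<nu> = \<one>\<^bsub>K\<^esub>"
    by (rule idempotent_character_grouplike[OF \<gamma>_char[OF one] \<gamma>_one_idem \<nu> \<nu>'])
  have m_unit: "m \<in> Units K"
    unfolding \<open>m = \<gamma> \<nu> \<nu>\<close> by (rule character_unit[OF \<gamma>_char[OF \<open>\<nu> \<in> \<Gamma>\<^sub>0\<close>] \<nu>(1) \<nu>'])
  have m_K: "\<one>\<^bsub>K\<^esub> \<otimes>\<^bsub>K\<^esub> m = m"
    using m_unit by (auto simp: Units_def cring.cring_simprules[OF is_cring])
  have pairing: "\<gamma> (cyclic_lam H N \<nu> i j) (cyclic_lam H N \<nu> k l) = m [^]\<^bsub>K\<^esub> (carry N i j * carry N k l)"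
    for i j k l
    using \<gamma>_one m_K \<open>m = \<gamma> \<nu> \<nu>\<close> character_eval(5)[OF \<gamma>_char[OF one]]
      character_eval(5)[OF \<gamma>_char[OF \<open>\<nu> \<in> \<Gamma>\<^sub>0\<close>]]
    by (simp add: cyclic_lam_def carry_def)
  have carrier: "carrier (integer_mod_group N) = {0..<int N}"
    using \<open>N \<ge> 1\<close> by (simp add: carrier_integer_mod_group)
  have "associative_zesting_datum K H (integer_mod_group N) \<pi> \<Gamma>\<^sub>0 \<gamma>
      (cyclic_lam H N \<nu>) (cyclic_\<omega> K N q)"
    if q: "q \<in> Units K" and qN: "q [^]\<^bsub>K\<^esub> N = m" for q
  proof (intro associative_zesting_datum.intro zesting_setting.intro
      associative_zesting_datum_axioms.intro zesting_setting_axioms.intro)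
    show "hopf_algebra K H" "group (integer_mod_group N)"
      by (fact assms) simp
    show "\<pi> \<in> hopf_hom K H (group_algebra K (integer_mod_group N))"
      "\<pi> ` carrier H = carrier (group_algebra K (integer_mod_group N))"
      "cocentral K H (group_algebra K (integer_mod_group N)) \<pi>"
      "subgroup \<Gamma>\<^sub>0 (grouplikes K H (coinvariants K H (group_algebra K (integer_mod_group N)) \<pi>))"
      "\<gamma> \<in> hom (grouplikes K H (coinvariants K H (group_algebra K (integer_mod_group N)) \<pi>)
          \<lparr>carrier := \<Gamma>\<^sub>0\<rparr>) (characters K H)"
      "zesting_compatible K H \<Gamma>\<^sub>0 \<gamma>"
      using assms by (simp_all add: B_def GH_def)
  next
    fix i j
    show "cyclic_lam H N \<nu> i j \<in> \<Gamma>\<^sub>0"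
      using one \<open>\<nu> \<in> \<Gamma>\<^sub>0\<close> by (simp add: cyclic_lam_def)
  next
    fix i j k
    assume "i \<in> carrier (integer_mod_group N)" "j \<in> carrier (integer_mod_group N)"
      "k \<in> carrier (integer_mod_group N)"
    then have ijk: "i \<in> {0..<int N}" "j \<in> {0..<int N}" "k \<in> {0..<int N}"
      by (simp_all only: carrier)
    show "cyclic_lam H N \<nu> i j \<otimes>\<^bsub>H\<^esub> cyclic_lam H N \<nu> (i \<otimes>\<^bsub>integer_mod_group N\<^esub> j) k =
        cyclic_lam H N \<nu> j k \<otimes>\<^bsub>H\<^esub> cyclic_lam H N \<nu> i (j \<otimes>\<^bsub>integer_mod_group N\<^esub> k)"
      using carry_cocycle[OF ijk] \<nu>(1)
      by (simp add: cyclic_lam_carry[OF H_monoid] monoid.nat_pow_mult[OF H_monoid])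
    show "cyclic_\<omega> K N q i j k \<in> Units K"
      using monoid.Units_nat_pow_closed[OF K_monoid q] by (simp add: cyclic_\<omega>_carry)
    show "cyclic_\<omega> K N q i j k = \<one>\<^bsub>K\<^esub>"
      if "i = \<one>\<^bsub>integer_mod_group N\<^esub> \<or> j = \<one>\<^bsub>integer_mod_group N\<^esub> \<or> k = \<one>\<^bsub>integer_mod_group N\<^esub>"
      using that ijk by (auto simp: cyclic_\<omega>_def)
  next
    fix i
    assume "i \<in> carrier (integer_mod_group N)"
    then show "cyclic_lam H N \<nu> i \<one>\<^bsub>integer_mod_group N\<^esub> = \<one>\<^bsub>H\<^esub> \<and>
        cyclic_lam H N \<nu> \<one>\<^bsub>integer_mod_group N\<^esub> i = \<one>\<^bsub>H\<^esub>"
      by (simp add: carrier cyclic_lam_def)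
  next
    fix i j k l
    assume "i \<in> carrier (integer_mod_group N)" "j \<in> carrier (integer_mod_group N)"
      "k \<in> carrier (integer_mod_group N)" "l \<in> carrier (integer_mod_group N)"
    then have ijkl: "i \<in> {0..<int N}" "j \<in> {0..<int N}" "k \<in> {0..<int N}" "l \<in> {0..<int N}"
      by (simp_all only: carrier)
    show "\<gamma> (cyclic_lam H N \<nu> i j) (cyclic_lam H N \<nu> k l) =
        (cyclic_\<omega> K N q i j k \<otimes>\<^bsub>K\<^esub> cyclic_\<omega> K N q i (j \<otimes>\<^bsub>integer_mod_group N\<^esub> k) l
          \<otimes>\<^bsub>K\<^esub> cyclic_\<omega> K N q j k l)
        \<otimes>\<^bsub>K\<^esub> inv\<^bsub>K\<^esub> (cyclic_\<omega> K N q (i \<otimes>\<^bsub>integer_mod_group N\<^esub> j) k l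
          \<otimes>\<^bsub>K\<^esub> cyclic_\<omega> K N q i j (k \<otimes>\<^bsub>integer_mod_group N\<^esub> l))"
      using cyclic_\<omega>_coboundary[OF q ijkl] by (simp add: pairing qN)
  qed
  with m_unit show ?thesis
    by blast
qed

end
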